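(* For all integers $m\geqslant l\geqslant 1$ and every positive integer $n$, $$\kappa_l(n,m)\geqslant\max_{2\leqslant i\leqslant m}\left\{\kappa_{\,l-\binom{m-2}{i-2}}\left(n-\binom{m}{i},\,m\right)+\binom{m-1}{i-1}\right\}.$$
   Context: For an integer $n$, $[n]=\{1,\ldots,n\}$ (empty if $n\leqslant 0$). A family $\mathcal{F}$ of subsets of $[n]$ is an $m$-family if it has $m$ members (required to be pairwise distinct subsets); it is $k$-uniform if every member has size $k$; for a set $L$ of nonnegative integers it is $L$-intersecting if $|F\cap F'|\in L$ for every two distinct members $F,F'$. For an integer $l\geqslant 0$, $\kappa_l(n,m)$ denotes the maximum $k$ such that there exists a $k$-uniform $\{l\}$-intersecting $m$-family of subsets of $[n]$, with $\kappa_l(n,m)=-\infty$ if no such family exists; by convention $\kappa_l(n,m)=-\infty$ when $l$ is negative. Here $-\infty+c=-\infty$. *)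

theory Defs
  imports "HOL-Library.Extended_Real"
begin

(* The ground set [n] is {1..n} over int, hence empty for n \<le> 0. *)
definition is_family :: "int \<Rightarrow> nat \<Rightarrow> int set set \<Rightarrow> bool" where
  "is_family n m \<F> \<longleftrightarrow> \<F> \<subseteq> Pow {1..n} \<and> card \<F> = m"

definition uniform_family :: "nat \<Rightarrow> int set set \<Rightarrow> bool" where
  "uniform_family k \<F> \<longleftrightarrow> (\<forall>F\<in>\<F>. card F = k)"

definition intersecting_family :: "nat set \<Rightarrow> int set set \<Rightarrow> bool" where
  "intersecting_family L \<F> \<longleftrightarrow> (\<forall>F\<in>\<F>. \<forall>F'\<in>\<F>. F \<noteq> F' \<longrightarrow> card (F \<inter> F') \<in> L)"

definition feasible_sizes :: "nat \<Rightarrow> int \<Rightarrow> nat \<Rightarrow> nat set" where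
  "feasible_sizes l n m =
     {k. \<exists>\<F>. is_family n m \<F> \<and> uniform_family k \<F> \<and> intersecting_family {l} \<F>}"

(* For m = 0 every k is vacuously feasible and there is no maximum; for m \<ge> 1 the
   following lemma guarantees that Max below is a genuine maximum. *)
lemma finite_feasible_sizes:
  assumes "m \<ge> 1"
  shows "finite (feasible_sizes l n m)"
proof (rule finite_subset)
  show "feasible_sizes l n m \<subseteq> {..card {1..n}}"
  proof
    fix k assume "k \<in> feasible_sizes l n m"
    then obtain \<F> where F: "\<F> \<subseteq> Pow {1..n}" "card \<F> = m" "\<forall>F\<in>\<F>. card F = k"
      by (auto simp: feasible_sizes_def is_family_def uniform_family_def)
    with assms have "\<F> \<noteq> {}" by auto
    then obtain A where "A \<in> \<F>" by blast
    with F have "A \<subseteq> {1..n}" "card A = k" by auto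
    then show "k \<in> {..card {1..n}}" using card_mono[of "{1..n}" A] by simp
  qed
qed simp

definition kappa :: "int \<Rightarrow> int \<Rightarrow> nat \<Rightarrow> ereal" where
  "kappa l n m =
     (if l < 0 \<or> feasible_sizes (nat l) n m = {} then -\<infinity>
      else ereal (real (Max (feasible_sizes (nat l) n m))))"

end

theory Submission imports Defs begin

text \<open>
  Given a \<open>k\<close>-uniform family with \<open>m\<close> members, adjoin one new point for every \<open>i\<close>-element subfamily
  and add this point to the members of that subfamily. Every member gains \<open>(m-1) choose (i-1)\<close>
  points, and every two members gain \<open>(m-2) choose (i-2)\<close> common points.
\<close>

text \<open>Deleting \<open>C\<close> from such a set \<open>T\<close> leaves an arbitrary subset of
  \<open>A - C\<close> of size \<open>i - card C\<close>. With \<open>C\<close> a singleton or a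
  pair, this counts the new points in one member or common to two members.\<close>

lemma card_subsets_containing:
  assumes "finite A" and "C \<subseteq> A" and "card C \<le> i"
  shows "card {T. T \<subseteq> A \<and> card T = i \<and> C \<subseteq> T} = (card A - card C) choose (i - card C)"
proof -
  have finC: "finite C" using assms finite_subset by blast
  have "bij_betw (\<lambda>U. U \<union> C) {U. U \<subseteq> A - C \<and> card U = i - card C}
          {T. T \<subseteq> A \<and> card T = i \<and> C \<subseteq> T}"
  proof (rule bij_betw_byWitness[where f' = "\<lambda>T. T - C"])
    show "(\<lambda>U. U \<union> C) ` {U. U \<subseteq> A - C \<and> card U = i - card C}
            \<subseteq> {T. T \<subseteq> A \<and> card T = i \<and> C \<subseteq> T}"
    proof clarsimp
      fix U assume U: "U \<subseteq> A - C" "card U = i - card C"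
      have "finite U" "U \<inter> C = {}" using U assms finite_subset by blast+
      then have "card (U \<union> C) = i" using U finC assms by (simp add: card_Un_disjoint)
      then show "U \<subseteq> A \<and> C \<subseteq> A \<and> card (U \<union> C) = i" using U assms by auto
    qed
    show "(\<lambda>T. T - C) ` {T. T \<subseteq> A \<and> card T = i \<and> C \<subseteq> T}
            \<subseteq> {U. U \<subseteq> A - C \<and> card U = i - card C}"
      using finC by (auto simp: card_Diff_subset)
  qed auto
  then have "card {T. T \<subseteq> A \<and> card T = i \<and> C \<subseteq> T}
      = card {U. U \<subseteq> A - C \<and> card U = i - card C}"
    by (simp add: bij_betw_same_card)
  also have "\<dots> = card (A - C) choose (i - card C)"
    using assms by (intro n_subsets) simp
  finally show ?thesis using assms finC by (simp add: card_Diff_subset)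
qed

text \<open>The intersection size is written as a sum over \<open>nat\<close>, starting from the
  smaller family, so no truncated subtraction occurs; the theorem applies this to the largest
  feasible \<open>k\<close>.\<close>

lemma feasible_sizes_extend:
  fixes n :: int
  assumes k: "k \<in> feasible_sizes l (n - int (m choose i)) m" and "2 \<le> i" and "i \<le> m"
  shows "k + ((m - 1) choose (i - 1)) \<in> feasible_sizes (l + ((m - 2) choose (i - 2))) n m"
proof -
  define n' where "n' = n - int (m choose i)"
  obtain \<F> where sub: "\<F> \<subseteq> Pow {1..n'}" and card: "card \<F> = m"
    and unif: "\<And>F. F \<in> \<F> \<Longrightarrow> card F = k"
    and inter: "\<And>F F'. F \<in> \<F> \<Longrightarrow> F' \<in> \<F> \<Longrightarrow> F \<noteq> F' \<Longrightarrow> card (F \<inter> F') = l"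
    using k unfolding feasible_sizes_def is_family_def uniform_family_def intersecting_family_def n'_def
    by auto
  have fin: "finite \<F>" using sub by (rule finite_subset) simp
  have finF: "finite F" if "F \<in> \<F>" for F using that sub finite_subset[of F "{1..n'}"] by auto
  \<comment> \<open>For negative \<open>n'\<close> the old ground set is empty and carries at most
    one member, while \<open>m\<close> is at least 2. Nonnegativity keeps the new points
    \<open>{n'+1..n}\<close> inside \<open>{1..n}\<close>.\<close>
  have n': "0 \<le> n'"
  proof (rule ccontr)
    assume "\<not> 0 \<le> n'"
    then have "\<F> \<subseteq> {{}}" using sub by auto
    then have "card \<F> \<le> card {{} :: int set}" by (intro card_mono) auto
    then show False using card assms by simp
  qed
  define S where "S = {T. T \<subseteq> \<F> \<and> card T = i}"
  have finS: "finite S" using fin by (simp add: S_def)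
  have "card S = m choose i" using n_subsets[OF fin] card by (simp add: S_def)
  \<comment> \<open>Passing from \<open>n'\<close> to \<open>n\<close> frees exactly one point for
    each \<open>i\<close>-subset of the family; \<open>b\<close> assigns these points.\<close>
  then have "card S = card {n'+1..n}" by (simp add: n'_def)
  then obtain b where b: "bij_betw b S {n'+1..n}"
    using finite_same_card_bij[OF finS, of "{n'+1..n}"] by blast
  have injb: "inj_on b S" and rangeb: "b ` S = {n'+1..n}" using b by (auto simp: bij_betw_def)
  define G where "G F = F \<union> b ` {T \<in> S. F \<in> T}" for F
  have low: "F \<subseteq> {1..n'}" if "F \<in> \<F>" for F using that sub by auto
  have high: "b ` {T \<in> S. P T} \<subseteq> {n'+1..n}" for P using rangeb by auto
  \<comment> \<open>Restricting to the old points recovers \<open>F\<close>, so distinct members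
    stay distinct after the extension.\<close>
  have G_low: "G F \<inter> {1..n'} = F" if "F \<in> \<F>" for F
    unfolding G_def using low[OF that] high[of "\<lambda>T. F \<in> T"] by fastforce
  have injG: "inj_on G \<F>" by (rule inj_onI) (metis G_low)
  have cardb: "card (b ` {T \<in> S. P T}) = card {T \<in> S. P T}" for P
    by (rule card_image) (rule inj_on_subset[OF injb], auto)
  \<comment> \<open>The predicate \<open>P\<close> is left general: it is later instantiated with
    containing one given member, and with containing two.\<close>
  have cardUn: "card (X \<union> b ` {T \<in> S. P T}) = card X + card {T \<in> S. P T}" if "X \<subseteq> {1..n'}" for X P
  proof -
    have "X \<inter> b ` {T \<in> S. P T} = {}" using that high[of P] by fastforce
    moreover have "finite X" using that finite_subset by blast
    ultimately show ?thesis using finS by (simp add: card_Un_disjoint cardb)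
  qed
  have degree: "card {T \<in> S. F \<in> T} = (m - 1) choose (i - 1)" if "F \<in> \<F>" for F
    using card_subsets_containing[OF fin, of "{F}" i] that assms card
    by (simp add: S_def conj_assoc)
  have codegree: "card {T \<in> S. F \<in> T \<and> F' \<in> T} = (m - 2) choose (i - 2)"
    if "F \<in> \<F>" "F' \<in> \<F>" "F \<noteq> F'" for F F'
    using card_subsets_containing[OF fin, of "{F, F'}" i] that assms card
    by (simp add: S_def conj_assoc numeral_2_eq_2)
  have "G ` \<F> \<subseteq> Pow {1..n}"
  proof clarify
    fix F x assume F: "F \<in> \<F>" and "x \<in> G F"
    then have "x \<in> {1..n'} \<union> {n'+1..n}"
      using low[OF F] high[of "\<lambda>T. F \<in> T"] unfolding G_def by blast
    moreover have "n' \<le> n" by (simp add: n'_def)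
    ultimately show "x \<in> {1..n}" using n' by auto
  qed
  moreover have "card (G ` \<F>) = m" using injG card by (simp add: card_image)
  moreover have "card (G F) = k + ((m - 1) choose (i - 1))" if "F \<in> \<F>" for F
    using that by (simp add: G_def cardUn low unif degree)
  moreover have "card (G F \<inter> G F') = l + ((m - 2) choose (i - 2))"
    if F: "F \<in> \<F>" "F' \<in> \<F>" and ne: "F \<noteq> F'" for F F'
  proof -
    \<comment> \<open>Injectivity of \<open>b\<close> makes a common new point come from a single
      subfamily containing both members.\<close>
    have "b ` {T \<in> S. F \<in> T} \<inter> b ` {T \<in> S. F' \<in> T} = b ` {T \<in> S. F \<in> T \<and> F' \<in> T}"
      using injb by (auto simp: inj_on_def)
    \<comment> \<open>The mixed terms vanish: old points are at most \<open>n'\<close>, new ones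
      exceed it.\<close>
    moreover have "F \<inter> b ` {T \<in> S. F' \<in> T} = {}" "F' \<inter> b ` {T \<in> S. F \<in> T} = {}"
      using low[OF F(1)] low[OF F(2)] high[of "\<lambda>T. F \<in> T"] high[of "\<lambda>T. F' \<in> T"] by fastforce+
    ultimately have "G F \<inter> G F' = (F \<inter> F') \<union> b ` {T \<in> S. F \<in> T \<and> F' \<in> T}"
      unfolding G_def by blast
    moreover have "F \<inter> F' \<subseteq> {1..n'}" using low[OF F(1)] by blast
    ultimately show ?thesis using F ne by (simp add: cardUn inter codegree)
  qed
  ultimately show ?thesis
    unfolding feasible_sizes_def is_family_def uniform_family_def intersecting_family_def
    by (intro CollectI exI[of _ "G ` \<F>"] conjI ballI impI) (force, force, force, metis imageE singletonI)
qed

theorem theorem2p5: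
  fixes m :: nat and l n :: int
  assumes "1 \<le> l" and "l \<le> int m" and "0 < n"
  shows "kappa l n m \<ge>
    (SUP i\<in>{2..m}. kappa (l - int ((m - 2) choose (i - 2))) (n - int (m choose i)) m
                    + ereal (real ((m - 1) choose (i - 1))))"
\<comment> \<open>For \<open>m = 1\<close> the index range is empty and the supremum is
  -\<infinity>, so nothing remains to be shown.\<close>
proof (rule SUP_least)
  fix i assume "i \<in> {2..m}"
  then have i: "2 \<le> i" "i \<le> m" by auto
  define l' where "l' = l - int ((m - 2) choose (i - 2))"
  define A where "A = feasible_sizes (nat l') (n - int (m choose i)) m"
  define B where "B = feasible_sizes (nat l) n m"
  define d where "d = (m - 1) choose (i - 1)"
  have "kappa l' (n - int (m choose i)) m + ereal (real d) \<le> kappa l n m"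
  \<comment> \<open>In the first case the left side is -\<infinity>, since adding a real number does
    not change that value.\<close>
  proof (cases "l' < 0 \<or> A = {}")
    case True
    then show ?thesis by (auto simp: kappa_def A_def)
  next
    case False
    have finA: "finite A" and finB: "finite B"
      using i finite_feasible_sizes by (auto simp: A_def B_def)
    have "Max A \<in> A" using False finA by simp
    then have "Max A + d \<in> feasible_sizes (nat l' + ((m - 2) choose (i - 2))) n m"
      using feasible_sizes_extend i by (simp add: A_def d_def)
    \<comment> \<open>Here \<open>l'\<close> is nonnegative, so \<open>nat\<close> loses
      nothing.\<close>
    moreover have "nat l' + ((m - 2) choose (i - 2)) = nat l"
      using False unfolding l'_def by linarith
    ultimately have mem: "Max A + d \<in> B" by (simp add: B_def)
    then have "Max A + d \<le> Max B" using finB by simp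
    then have "real (Max A) + real d \<le> real (Max B)" by linarith
    \<comment> \<open>\<open>mem\<close> also shows that \<open>B\<close> is nonempty; with
      \<open>l\<close> positive, the right side is therefore the finite value
      \<open>Max B\<close>.\<close>
    then show ?thesis using False mem assms by (auto simp: kappa_def A_def B_def)
  qed
  then show "kappa (l - int ((m - 2) choose (i - 2))) (n - int (m choose i)) m
      + ereal (real ((m - 1) choose (i - 1))) \<le> kappa l n m"
    by (simp add: l'_def d_def)
qed

end
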